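(* Let $\mathfrak B$ be a Banach space, $f\in C(\mathbb R,\mathfrak B)$, $F\in C(\mathbb R\times\mathfrak B,\mathfrak B)$ with $F(t,0)=0$ for all $t\in\mathbb R$, and $A\in C(\mathbb R,[\mathfrak B])$. Assume: 1) the linear equation $x'=A(t)x$ has an exponential trichotomy on $\mathbb R$ with projections $P,Q$ and constants $\mathcal N\ge1$, $\nu>0$; 2) the functions $A$, $f$ and $F$ are Lagrange stable; 3) $|F(t,u_1)-F(t,u_2)|\le L|u_1-u_2|$ for all $t\in\mathbb R$, $u_1,u_2\in\mathfrak B$, with a constant $L<\frac{\nu}{2\mathcal N}$; 4) (Condition (C)) the family of projections $\{U(t,A)PU^{-1}(t,A)\}_{t\in\mathbb R}$ is a precompact subset of $[\mathfrak B]$. Let $\varphi$ be the Lagrange stable solution of $u'=A(t)u+f(t)+F(t,u)$ on $\mathbb R$ defined by $$\varphi(t)=\int_{-\infty}^{+\infty}G_A(t,\tau)\bigl[f(\tau)+F(\tau,\varphi(\tau))\bigr]\,d\tau\quad(t\in\mathbb R),$$ where $G_A$ is the Green function associated with the trichotomy, and let $Q_\varphi:=\overline{\varphi(\mathbb R)}$. Then $\varphi$ is remotely compatible, i.e. $\mathfrak L_{(A,f,F_{Q_\varphi})}\subseteq\mathfrak L_\varphi$, where $F_{Q_\varphi}:=F|_{\mathbb R\times Q_\varphi}$.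
   Context: $\mathfrak B$ is a real or complex Banach space with norm $|\cdot|$; $[\mathfrak B]$ is the Banach space of bounded linear operators on $\mathfrak B$ with the operator norm. For a metric space $E$, $C(\mathbb R,E)$ carries the topology of uniform convergence on compact sets; $C(\mathbb R\times\mathfrak B,\mathfrak B)$ and, for compact $K\subset\mathfrak B$, $C(\mathbb R\times K,\mathfrak B)$ carry the compact-open topology; $g^h(t):=g(t+h)$ and $F^h(t,x):=F(t+h,x)$. A function $g$ in one of these spaces is Lagrange stable if the set of its translates $\{g^h:h\in\mathbb R\}$ is precompact in that space. $\mathfrak L_\varphi$ is the set of all real sequences $\{t_n\}$ with $t_n\to+\infty$ or $t_n\to-\infty$ such that $\{\varphi^{t_n}\}$ converges in $C(\mathbb R,\mathfrak B)$. For compact $K\subset\mathfrak B$, $\mathfrak L_{(A,f,F_K)}$ is the set of all real sequences $\{t_n\}$ with $t_n\to+\infty$ or $t_n\to-\infty$ such that $A^{t_n}$, $f^{t_n}$ and $F_K^{t_n}$ converge in $C(\mathbb R,[\mathfrak B])$, $C(\mathbb R,\mathfrak B)$ and $C(\mathbb R\times K,\mathfrak B)$ respectively. $U(t,A)$ denotes the Cauchy operator of $x'=A(t)x$ (so $U(0,A)=I$ and $t\mapsto U(t,A)x$ is the solution with value $x$ at $t=0$). The equation $x'=A(t)x$ has an exponential trichotomy on $\mathbb R$ with projections $P,Q$ and constants $\mathcal N\ge1$, $\nu>0$ if $P,Q$ are bounded linear projections on $\mathfrak B$ with $PQ=QP$, $P+Q-PQ=I$ and $\|U(t,A)PU^{-1}(\tau,A)\|\le\mathcal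 N e^{-\nu(t-\tau)}$ for $0\le\tau\le t$; $\|U(t,A)(I-P)U^{-1}(\tau,A)\|\le\mathcal N e^{-\nu(\tau-t)}$ for $t\le\tau$, $\tau\ge0$; $\|U(t,A)QU^{-1}(\tau,A)\|\le\mathcal N e^{-\nu(\tau-t)}$ for $t\le\tau\le0$; $\|U(t,A)(I-Q)U^{-1}(\tau,A)\|\le\mathcal N e^{-\nu(t-\tau)}$ for $\tau\le t$, $\tau\le0$. The associated Green function is: $G_A(t,\tau)=U(t,A)PU^{-1}(\tau,A)$ if $0\le\tau<t$; $G_A(t,\tau)=-U(t,A)(I-P)U^{-1}(\tau,A)$ if $t\le\tau$, $\tau\ge0$; $G_A(t,\tau)=-U(t,A)QU^{-1}(\tau,A)$ if $t\le\tau\le0$; $G_A(t,\tau)=U(t,A)(I-Q)U^{-1}(\tau,A)$ if $\tau\le t$, $\tau\le0$ (the cases overlap only for $\tau=0$ or $\tau=t$, which does not affect the integral). *)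

theory Defs
  imports "HOL-Analysis.Analysis"
begin

text \<open>
  The state space is a real Banach space, i.e. a type of class \<^class>\<open>banach\<close>. The complex case is
  the special case of the underlying real space: the complex-linear bounded operators form a
  subspace of the real-linear ones with the same norm, and none of the notions below refers to
  scalars.
\<close>

section \<open>Function spaces\<close>

definition cts_on :: "'a::topological_space set \<Rightarrow> ('a \<Rightarrow> 'b::topological_space) set" where
  "cts_on S = {f \<in> extensional S. continuous_on S f}"

text \<open>Uniform convergence on compact sets, given by the subbasis of sets
  \<open>{g. \<forall>t\<in>K. dist (f t) (g t) < e}\<close>.\<close>

definition unif_compact_topology :: "(real \<Rightarrow> 'b::metric_space) topology" where
  "unif_compact_topology = topology_generated_by
     {{g \<in> cts_on UNIV. \<forall>t\<in>K. dist (f t) (g t) < e} | f K e.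
        f \<in> cts_on UNIV \<and> compact K \<and> 0 < e}"

definition compact_open_topology ::
  "'a::topological_space set \<Rightarrow> ('a \<Rightarrow> 'b::topological_space) topology" where
  "compact_open_topology S = topology_generated_by
     {{g \<in> cts_on S. g ` K \<subseteq> V} | K V. K \<subseteq> S \<and> compact K \<and> open V}"

definition precompact_in :: "'a topology \<Rightarrow> 'a set \<Rightarrow> bool" where
  "precompact_in X M \<longleftrightarrow> M \<subseteq> topspace X \<and> compactin X (X closure_of M)"

definition shift :: "real \<Rightarrow> (real \<Rightarrow> 'b) \<Rightarrow> real \<Rightarrow> 'b" where
  "shift h g = (\<lambda>t. g (t + h))"

definition shift2 :: "real \<Rightarrow> (real \<times> 'a \<Rightarrow> 'b) \<Rightarrow> real \<times> 'a \<Rightarrow> 'b" where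
  "shift2 h F = (\<lambda>(t, x). F (t + h, x))"

definition lagrange_stable :: "(real \<Rightarrow> 'b::metric_space) \<Rightarrow> bool" where
  "lagrange_stable g \<longleftrightarrow> precompact_in unif_compact_topology (range (\<lambda>h. shift h g))"

definition lagrange_stable2 ::
  "(real \<times> 'a::topological_space \<Rightarrow> 'b::topological_space) \<Rightarrow> bool" where
  "lagrange_stable2 F \<longleftrightarrow> precompact_in (compact_open_topology UNIV) (range (\<lambda>h. shift2 h F))"

definition to_infinity :: "(nat \<Rightarrow> real) \<Rightarrow> bool" where
  "to_infinity s \<longleftrightarrow> filterlim s at_top sequentially \<or> filterlim s at_bot sequentially"

definition converges_in :: "'a topology \<Rightarrow> (nat \<Rightarrow> 'a) \<Rightarrow> bool" where
  "converges_in X g \<longleftrightarrow> (\<exists>l. limitin X g l sequentially)"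

definition limit_seqs :: "(real \<Rightarrow> 'b::metric_space) \<Rightarrow> (nat \<Rightarrow> real) set" where
  "limit_seqs \<phi> =
     {s. to_infinity s \<and> converges_in unif_compact_topology (\<lambda>n. shift (s n) \<phi>)}"

text \<open>In \<open>limit_seqs_AfF A f K F\<^sub>K\<close> the last argument is a function on \<open>\<real> \<times> K\<close>
  (extended by \<^const>\<open>undefined\<close>).\<close>

definition limit_seqs_AfF ::
  "(real \<Rightarrow> 'a \<Rightarrow>\<^sub>L 'a) \<Rightarrow> (real \<Rightarrow> 'a) \<Rightarrow> 'a set \<Rightarrow> (real \<times> 'a \<Rightarrow> 'a::banach)
     \<Rightarrow> (nat \<Rightarrow> real) set" where
  "limit_seqs_AfF A f K F\<^sub>K =
     {s. to_infinity s
        \<and> converges_in unif_compact_topology (\<lambda>n. shift (s n) A)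
        \<and> converges_in unif_compact_topology (\<lambda>n. shift (s n) f)
        \<and> converges_in (compact_open_topology (UNIV \<times> K)) (\<lambda>n. shift2 (s n) F\<^sub>K)}"

section \<open>Linear equations\<close>

text \<open>For continuous \<open>A\<close> the description is met by exactly one \<open>U\<close>.\<close>

definition cauchy_op :: "(real \<Rightarrow> 'a::banach \<Rightarrow>\<^sub>L 'a) \<Rightarrow> real \<Rightarrow> 'a \<Rightarrow>\<^sub>L 'a" where
  "cauchy_op A = (THE U. U 0 = id_blinfun \<and>
     (\<forall>x t. ((\<lambda>s. blinfun_apply (U s) x) has_vector_derivative
               blinfun_apply (A t) (blinfun_apply (U t) x)) (at t)))"

definition inv_blinfun :: "'a::real_normed_vector \<Rightarrow>\<^sub>L 'a \<Rightarrow> 'a \<Rightarrow>\<^sub>L 'a" where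
  "inv_blinfun T = (THE S. S o\<^sub>L T = id_blinfun \<and> T o\<^sub>L S = id_blinfun)"

text \<open>The operator \<open>U(t,A) R U\<^sup>-\<^sup>1(\<tau>,A)\<close>.\<close>

definition transported ::
  "(real \<Rightarrow> 'a::banach \<Rightarrow>\<^sub>L 'a) \<Rightarrow> 'a \<Rightarrow>\<^sub>L 'a \<Rightarrow> real \<Rightarrow> real \<Rightarrow> 'a \<Rightarrow>\<^sub>L 'a" where
  "transported A R t \<tau> = cauchy_op A t o\<^sub>L R o\<^sub>L inv_blinfun (cauchy_op A \<tau>)"

definition exponential_trichotomy ::
  "(real \<Rightarrow> 'a::banach \<Rightarrow>\<^sub>L 'a) \<Rightarrow> 'a \<Rightarrow>\<^sub>L 'a \<Rightarrow> 'a \<Rightarrow>\<^sub>L 'a \<Rightarrow> real \<Rightarrow> real \<Rightarrow> bool" where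
  "exponential_trichotomy A P Q N \<nu> \<longleftrightarrow>
     1 \<le> N \<and> 0 < \<nu> \<and>
     P o\<^sub>L P = P \<and> Q o\<^sub>L Q = Q \<and>
     P o\<^sub>L Q = Q o\<^sub>L P \<and> P + Q - (P o\<^sub>L Q) = id_blinfun \<and>
     (\<forall>t \<tau>. 0 \<le> \<tau> \<and> \<tau> \<le> t \<longrightarrow>
        norm (transported A P t \<tau>) \<le> N * exp (- \<nu> * (t - \<tau>))) \<and>
     (\<forall>t \<tau>. t \<le> \<tau> \<and> 0 \<le> \<tau> \<longrightarrow>
        norm (transported A (id_blinfun - P) t \<tau>) \<le> N * exp (- \<nu> * (\<tau> - t))) \<and>
     (\<forall>t \<tau>. t \<le> \<tau> \<and> \<tau> \<le> 0 \<longrightarrow>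
        norm (transported A Q t \<tau>) \<le> N * exp (- \<nu> * (\<tau> - t))) \<and>
     (\<forall>t \<tau>. \<tau> \<le> t \<and> \<tau> \<le> 0 \<longrightarrow>
        norm (transported A (id_blinfun - Q) t \<tau>) \<le> N * exp (- \<nu> * (t - \<tau>)))"

text \<open>The last case is \<open>\<tau> < t\<close>, \<open>\<tau> < 0\<close>. Where the usual case conditions overlap
  (\<open>\<tau> = 0\<close> or \<open>\<tau> = t\<close>) the first applicable case is taken.\<close>

definition green ::
  "(real \<Rightarrow> 'a::banach \<Rightarrow>\<^sub>L 'a) \<Rightarrow> 'a \<Rightarrow>\<^sub>L 'a \<Rightarrow> 'a \<Rightarrow>\<^sub>L 'a \<Rightarrow> real \<Rightarrow> real \<Rightarrow> 'a \<Rightarrow>\<^sub>L 'a" where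
  "green A P Q t \<tau> =
     (if 0 \<le> \<tau> \<and> \<tau> < t then transported A P t \<tau>
      else if t \<le> \<tau> \<and> 0 \<le> \<tau> then - transported A (id_blinfun - P) t \<tau>
      else if t \<le> \<tau> \<and> \<tau> \<le> 0 then - transported A Q t \<tau>
      else transported A (id_blinfun - Q) t \<tau>)"

end

theory Submission
  imports Defs
begin

text \<open>
  Let \<open>s\<^sub>n\<close> be a sequence along which the translates of \<open>A\<close>, \<open>f\<close> and \<open>F\<close> converge. For large \<open>m, n\<close>
  the difference \<open>w(t) = \<phi>(t + s\<^sub>m) - \<phi>(t + s\<^sub>n)\<close> solves \<open>w' = A(t + s\<^sub>m) w + g\<close> with
  \<open>|g| \<le> \<epsilon> + L |w|\<close> on a long interval around \<open>0\<close>, and \<open>A(t + s\<^sub>m)\<close> has a dichotomy there: its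
  projection is \<open>P\<close> if \<open>s\<^sub>n \<rightarrow> \<infinity>\<close> and \<open>I - Q\<close> if \<open>s\<^sub>n \<rightarrow> -\<infinity>\<close>. Variation of constants on
  \<open>[t - h, t + h]\<close> bounds \<open>|w(t)|\<close> by \<open>\<delta> + q sup |w|\<close> with \<open>q = 2 N L / \<nu> < 1\<close> and \<open>\<delta>\<close> small for
  large \<open>h\<close>. Iterating this over nested intervals makes \<open>w\<close> uniformly small on compact sets, so
  the translates of \<open>\<phi>\<close> form a Cauchy sequence and no limit equation has to be considered.
\<close>

section \<open>Linear differential equations\<close>

text \<open>The mean value inequality with the comparison function \<open>c * exp (K * s)\<close>,
  whose derivative is the assumed bound. Used with \<open>K\<close> twice the growth constant of the
  equation, it gains the factor 1/2 behind both uniqueness and Picard's contraction.\<close>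

lemma antiderivative_exp_bound:
  fixes H h :: "real \<Rightarrow> 'a::real_normed_vector"
  assumes deriv: "\<And>s. \<bar>s\<bar> \<le> \<bar>t\<bar> \<Longrightarrow> (H has_vector_derivative h s) (at s)"
    and bound: "\<And>s. \<bar>s\<bar> \<le> \<bar>t\<bar> \<Longrightarrow> norm (h s) \<le> c * K * exp (K * \<bar>s\<bar>)"
    and zero: "H 0 = 0"
  shows "norm (H t) \<le> c * (exp (K * \<bar>t\<bar>) - 1)"
proof -
  \<comment> \<open>Generalised over \<open>H\<close>, \<open>h\<close> and \<open>t\<close> so that
    it also applies to the time-reflected function when \<open>t < 0\<close>.\<close>
  have pos: "norm (H t) \<le> c * (exp (K * t) - 1)"
    if "0 < t"
      and d: "\<And>s. 0 \<le> s \<Longrightarrow> s \<le> t \<Longrightarrow> (H has_vector_derivative h s) (at s)"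
      and b: "\<And>s. 0 \<le> s \<Longrightarrow> s \<le> t \<Longrightarrow> norm (h s) \<le> c * K * exp (K * s)"
      and z: "H 0 = 0"
    for H h :: "real \<Rightarrow> 'a" and t :: real
  proof -
    have "norm (H t - H 0) \<le> c * exp (K * t) - c * exp (K * 0)"
    proof (rule differentiable_bound_general[OF \<open>0 < t\<close>])
      show "continuous_on {0..t} H"
        by (intro continuous_at_imp_continuous_on) (use has_vector_derivative_continuous[OF d] in auto)
      show "continuous_on {0..t} (\<lambda>s. c * exp (K * s))"
        by (intro continuous_intros)
      show "(H has_vector_derivative h s) (at s)" if "0 < s" "s < t" for s
        using d that by auto
      show "((\<lambda>s. c * exp (K * s)) has_vector_derivative (c * K * exp (K * s))) (at s)" for s
        unfolding has_real_derivative_iff_has_vector_derivative[symmetric]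
        by (auto intro!: derivative_eq_intros)
      show "norm (h s) \<le> c * K * exp (K * s)" if "0 < s" "s < t" for s
        using b that by auto
    qed
    then show ?thesis by (simp add: z algebra_simps)
  qed
  consider "t = 0" | "0 < t" | "t < 0" by linarith
  then show ?thesis
  proof cases
    case 2
    have "norm (H t) \<le> c * (exp (K * t) - 1)"
    proof (rule pos[where H = H and h = h, OF 2])
      show "(H has_vector_derivative h s) (at s)" if "0 \<le> s" "s \<le> t" for s
        using deriv[of s] that by simp
      show "norm (h s) \<le> c * K * exp (K * s)" if "0 \<le> s" "s \<le> t" for s
        using bound[of s] that by simp
    qed (fact zero)
    then show ?thesis using 2 by simp
  next
    case 3
    have "norm (H (- (- t))) \<le> c * (exp (K * (- t)) - 1)"
    proof (rule pos[of "- t" "\<lambda>s. H (- s)" "\<lambda>s. - h (- s)"])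
      show "((\<lambda>s. H (- s)) has_vector_derivative - h (- s)) (at s)" if "0 \<le> s" "s \<le> - t" for s
        using vector_diff_chain_at[OF has_vector_derivative_minus[OF has_vector_derivative_id]]
          deriv[of "- s"] that by (force simp: o_def)
      show "norm (- h (- s)) \<le> c * K * exp (K * s)" if "0 \<le> s" "s \<le> - t" for s
        using bound[of "- s"] that by simp
    qed (use 3 zero in auto)
    then show ?thesis using 3 by simp
  qed (simp add: zero)
qed

text \<open>Let \<open>t0\<close> maximise the norm of \<open>x\<close> weighted by
  \<open>exp (- (2 * b * \<bar>s\<bar>))\<close> on the symmetric interval reaching to
  \<open>t\<close>. Integrating the derivative bound from 0 shows that \<open>norm (x t0)\<close> is
  at most half of itself, so the maximum is 0.\<close>

lemma norm_derivative_le_imp_zero: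
  fixes x x' :: "real \<Rightarrow> 'a::real_normed_vector"
  assumes deriv: "\<And>t. (x has_vector_derivative x' t) (at t)"
    and bound: "\<And>t. norm (x' t) \<le> a * norm (x t)"
    and zero: "x 0 = 0"
  shows "x t = 0"
proof -
  \<comment> \<open>\<open>a\<close> may be zero or negative; \<open>b\<close> is a positive
    constant for which the bound persists.\<close>
  define b where "b = max a 1"
  have b: "b > 0" and bnd: "norm (x' s) \<le> b * norm (x s)" for s
    using bound[of s] mult_right_mono[of a b "norm (x s)"] unfolding b_def by auto
  let ?w = "\<lambda>s. exp (- (2 * b * \<bar>s\<bar>)) * norm (x s)"
  have "continuous_on {- \<bar>t\<bar>..\<bar>t\<bar>} x"
    by (intro continuous_at_imp_continuous_on) (use has_vector_derivative_continuous[OF deriv] in auto)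
  then have "continuous_on {- \<bar>t\<bar>..\<bar>t\<bar>} ?w"
    by (intro continuous_intros)
  then obtain t0 where t0: "t0 \<in> {- \<bar>t\<bar>..\<bar>t\<bar>}"
    and max: "\<And>s. s \<in> {- \<bar>t\<bar>..\<bar>t\<bar>} \<Longrightarrow> ?w s \<le> ?w t0"
    using continuous_attains_sup[of "{- \<bar>t\<bar>..\<bar>t\<bar>}" ?w] by auto
  have "norm (x t0) \<le> (?w t0 / 2) * (exp (2 * b * \<bar>t0\<bar>) - 1)"
  proof (rule antiderivative_exp_bound[OF deriv _ zero])
    fix s assume "\<bar>s\<bar> \<le> \<bar>t0\<bar>"
    then have "?w s \<le> ?w t0" using t0 by (intro max) auto
    then have "exp (2 * b * \<bar>s\<bar>) * ?w s \<le> exp (2 * b * \<bar>s\<bar>) * ?w t0"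
      by (rule mult_left_mono) simp
    then have "norm (x s) \<le> ?w t0 * exp (2 * b * \<bar>s\<bar>)"
      by (simp add: exp_minus field_simps)
    then have "b * norm (x s) \<le> b * (?w t0 * exp (2 * b * \<bar>s\<bar>))"
      using b by (intro mult_left_mono) auto
    then show "norm (x' s) \<le> ?w t0 / 2 * (2 * b) * exp (2 * b * \<bar>s\<bar>)"
      using bnd[of s] by (simp add: mult_ac)
  qed
  also have "\<dots> \<le> norm (x t0) / 2"
    by (simp add: exp_minus field_simps)
  finally have "?w t0 = 0" by simp
  then have "?w t \<le> 0" using max[of t] by (cases "0 \<le> t") auto
  then show ?thesis by (simp add: mult_le_0_iff)
qed

section \<open>Antiderivatives, global solutions and the Cauchy operator\<close>

lemma continuous_antiderivative:
  fixes h :: "real \<Rightarrow> 'a::banach"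
  assumes cont: "continuous_on UNIV h"
  obtains H where "H 0 = 0" "\<And>t. (H has_vector_derivative h t) (at t)"
\<comment> \<open>For either sign of \<open>t\<close> one of the integrals runs over an empty or
  one-point interval, so the difference is the oriented integral from 0 to \<open>t\<close>.\<close>
proof (rule that[of "\<lambda>t. integral {0..t} h - integral {t..0} h"])
  let ?H = "\<lambda>t. integral {0..t} h - integral {t..0} h"
  show "?H (0::real) = 0" by simp
  fix t :: real
  \<comment> \<open>Near \<open>t\<close> the oriented integral differs by a constant from the
    integral with fixed left endpoint \<open>- T\<close>, which lies below both 0 and
    \<open>t\<close>; the fundamental theorem then covers both signs at once.\<close>
  define T where "T = \<bar>t\<bar> + 1"
  have T: "T > 0" "- T < t" "t < T" unfolding T_def by auto
  have int: "h integrable_on {a..b}" for a b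
    using cont continuous_on_subset integrable_continuous_real subset_UNIV by blast
  have eq: "integral {- T..s} h - integral {- T..0} h = ?H s" if "s \<in> {- T<..<T}" for s
  proof (cases "0 \<le> s")
    case True
    then show ?thesis
      using Henstock_Kurzweil_Integration.integral_combine[
          where a = "- T" and c = 0 and b = s and f = h]
        int T by (cases "s = 0") (auto simp: algebra_simps)
  next
    case False
    then show ?thesis
      using Henstock_Kurzweil_Integration.integral_combine[
          where a = "- T" and c = s and b = 0 and f = h]
        int that by (auto simp: algebra_simps)
  qed
  have "((\<lambda>s. integral {- T..s} h) has_vector_derivative h t) (at t within {- T..T})"
    using cont T by (intro integral_has_vector_derivative) (auto intro: continuous_on_subset)
  then have "((\<lambda>s. integral {- T..s} h) has_vector_derivative h t) (at t within {- T<..<T})"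
    by (rule has_vector_derivative_within_subset) auto
  then have "((\<lambda>s. integral {- T..s} h - integral {- T..0} h) has_vector_derivative h t - 0)
      (at t within {- T<..<T})"
    by (rule has_vector_derivative_diff) simp
  then have "((\<lambda>s. integral {- T..s} h - integral {- T..0} h) has_vector_derivative h t) (at t)"
    using T by (subst (asm) at_within_open) auto
  then show "(?H has_vector_derivative h t) (at t)"
    by (rule has_vector_derivative_transform_within_open[of _ _ _ "{- T<..<T}"]) (use eq T in auto)
qed

text \<open>Picard's map is a contraction on functions weighted by \<open>exp (- 2 b \<bar>t\<bar>)\<close>.\<close>

lemma global_solution_exists:
  fixes g :: "real \<Rightarrow> 'a::banach \<Rightarrow> 'a"
  assumes cont: "\<And>x. continuous_on UNIV x \<Longrightarrow> continuous_on UNIV (\<lambda>t. g t (x t))"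
    and lip: "\<And>t x y. norm (g t x - g t y) \<le> a * norm (x - y)"
    and zero: "\<And>t. g t 0 = 0"
  obtains x where "x 0 = x0" "\<And>t. (x has_vector_derivative g t (x t)) (at t)"
proof -
  define b where "b = max a 1"
  have b: "b > 0" and lipb: "norm (g t x - g t y) \<le> b * norm (x - y)" for t x y
    using lip[of t x y] mult_right_mono[of a b "norm (x - y)"] unfolding b_def by auto
  \<comment> \<open>The solution is sought as \<open>?e t *\<^sub>R v t\<close> with
    \<open>v\<close> bounded and continuous: the sup norm of \<open>v\<close> is the weighted norm
    of the solution, and the space of such \<open>v\<close> is complete.\<close>
  let ?e = "\<lambda>t::real. exp (2 * b * \<bar>t\<bar>)"
  let ?v = "\<lambda>(v::real \<Rightarrow>\<^sub>C 'a) t. ?e t *\<^sub>R apply_bcontfun v t"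
  have ex: "\<exists>H. H 0 = 0 \<and> (\<forall>t. (H has_vector_derivative g t (?v v t)) (at t))" for v
  proof -
    have "continuous_on UNIV (\<lambda>t. g t (?v v t))"
      by (intro cont continuous_intros) auto
    then show ?thesis by (rule continuous_antiderivative) blast
  qed
  define J where "J v = (SOME H. H 0 = 0 \<and> (\<forall>t. (H has_vector_derivative g t (?v v t)) (at t)))"
    for v
  have J0: "J v 0 = 0" and J': "(J v has_vector_derivative g t (?v v t)) (at t)" for v t
    using someI_ex[OF ex[of v]] unfolding J_def by auto
  \<comment> \<open>The weight grows at rate \<open>2 * b\<close> while \<open>g\<close> has
    Lipschitz constant \<open>b\<close>, whence the factor 1/2.\<close>
  have J_diff: "norm (J v t - J w t) \<le> dist v w / 2 * ?e t" for v w t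
  proof -
    have "norm (J v t - J w t) \<le> (dist v w / 2) * (?e t - 1)"
    proof (rule antiderivative_exp_bound[where H = "\<lambda>t. J v t - J w t"])
      show "((\<lambda>t. J v t - J w t) has_vector_derivative g s (?v v s) - g s (?v w s)) (at s)" for s
        by (intro derivative_intros J')
      have "norm (g s (?v v s) - g s (?v w s)) \<le> b * (?e s * dist v w)" for s
      proof (rule order.trans[OF lipb mult_left_mono])
        have "norm (?v v s - ?v w s) = ?e s * dist (v s) (w s)"
          by (simp add: dist_norm flip: scaleR_diff_right)
        also have "\<dots> \<le> ?e s * dist v w"
          by (intro mult_left_mono dist_bounded) auto
        finally show "norm (?v v s - ?v w s) \<le> ?e s * dist v w" .
      qed (use b in simp)
      then show "norm (g s (?v v s) - g s (?v w s)) \<le> dist v w / 2 * (2 * b) * ?e s" for s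
        by (simp add: mult_ac)
    qed (simp add: J0)
    also have "\<dots> \<le> dist v w / 2 * ?e t"
      by (intro mult_left_mono) auto
    finally show ?thesis .
  qed
  \<comment> \<open>Comparison with \<open>J 0\<close> turns the estimate for differences into a
    growth bound for a single \<open>J v\<close>, so that Picard's map preserves
    boundedness.\<close>
  have J_zero: "J 0 t = 0" for t
    by (rule norm_derivative_le_imp_zero[where x = "J 0" and a = 0, OF J' _ J0]) (simp add: zero)
  have J_cont: "continuous_on UNIV (J v)" for v
    by (intro continuous_at_imp_continuous_on) (use has_vector_derivative_continuous[OF J'] in auto)
  let ?\<Phi> = "\<lambda>v t. exp (- (2 * b * \<bar>t\<bar>)) *\<^sub>R (x0 + J v t)"
  have \<Phi>_bcontfun: "?\<Phi> v \<in> bcontfun" for v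
  proof (rule bcontfun_normI)
    show "continuous_on UNIV (?\<Phi> v)"
      by (intro continuous_intros J_cont)
    show "norm (?\<Phi> v t) \<le> norm x0 + dist v 0 / 2" for t
    proof -
      have "norm (x0 + J v t) \<le> norm x0 * 1 + dist v 0 / 2 * ?e t"
        using norm_triangle_ineq[of x0 "J v t"] J_diff[of v t 0] by (simp add: J_zero)
      also have "\<dots> \<le> norm x0 * ?e t + dist v 0 / 2 * ?e t"
        using b by (intro add_mono mult_left_mono) auto
      finally have "exp (- (2 * b * \<bar>t\<bar>)) * norm (x0 + J v t)
          \<le> exp (- (2 * b * \<bar>t\<bar>)) * (norm x0 * ?e t + dist v 0 / 2 * ?e t)"
        by (intro mult_left_mono) auto
      also have "\<dots> = norm x0 + dist v 0 / 2"
        by (simp add: exp_minus field_simps)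
      finally show ?thesis by simp
    qed
  qed
  define \<Phi> where "\<Phi> v = Bcontfun (?\<Phi> v)" for v
  have \<Phi>: "apply_bcontfun (\<Phi> v) t = ?\<Phi> v t" for v t
    unfolding \<Phi>_def by (simp add: Bcontfun_inverse \<Phi>_bcontfun)
  have "\<exists>!v. \<Phi> v = v"
  proof (rule banach_fix_type)
    show "\<forall>v w. dist (\<Phi> v) (\<Phi> w) \<le> 1 / 2 * dist v w"
    proof (intro allI dist_bound)
      fix v w t
      have "dist (\<Phi> v t) (\<Phi> w t) = exp (- (2 * b * \<bar>t\<bar>)) * norm (J v t - J w t)"
        by (simp add: \<Phi> dist_norm flip: scaleR_diff_right)
      also have "\<dots> \<le> exp (- (2 * b * \<bar>t\<bar>)) * (dist v w / 2 * ?e t)"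
        by (intro mult_left_mono J_diff) auto
      finally show "dist (\<Phi> v t) (\<Phi> w t) \<le> 1 / 2 * dist v w"
        by (simp add: exp_minus field_simps)
    qed
  qed auto
  then obtain v where v: "\<Phi> v = v" by blast
  \<comment> \<open>Multiplying the fixed point equation by the weight recovers the integral form of
    the initial value problem.\<close>
  have eq: "?v v t = x0 + J v t" for t
    using \<Phi>[of v t] by (simp add: v exp_minus)
  show thesis
  proof
    show "x0 + J v 0 = x0" by (simp add: J0)
    show "((\<lambda>t. x0 + J v t) has_vector_derivative g t (x0 + J v t)) (at t)" for t
      using J'[of v t] unfolding eq by (auto intro!: derivative_eq_intros)
  qed
qed

text \<open>The inverse of \<open>U\<close> is the solution \<open>V\<close> of \<open>V' = - V A\<close>, \<open>V(0) = I\<close>: the operators \<open>V U\<close> and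
  \<open>Z = U V - I\<close> satisfy \<open>(V U)' = 0\<close> and \<open>Z' = A Z - Z A\<close>.\<close>

lemma cauchy_op_properties:
  fixes A :: "real \<Rightarrow> 'a::banach \<Rightarrow>\<^sub>L 'a"
  assumes cont: "continuous_on UNIV A" and bdd: "\<And>t. norm (A t) \<le> a"
  shows "cauchy_op A t o\<^sub>L inv_blinfun (cauchy_op A t) = id_blinfun"
    and "((\<lambda>t. inv_blinfun (cauchy_op A t)) has_vector_derivative
           - (inv_blinfun (cauchy_op A t) o\<^sub>L A t)) (at t)"
proof -
  note comp_bil = bounded_bilinear_blinfun_compose
  have comp_le: "norm (A t o\<^sub>L X) \<le> a * norm X" "norm (X o\<^sub>L A t) \<le> a * norm X" for t and X :: "'a \<Rightarrow>\<^sub>L 'a"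
    using norm_blinfun_compose[of "A t" X] norm_blinfun_compose[of X "A t"]
      mult_right_mono[OF bdd[of t] norm_ge_zero[of X]] by (simp_all add: mult.commute)
  obtain U where U0: "U 0 = id_blinfun"
    and U': "\<And>t. (U has_vector_derivative A t o\<^sub>L U t) (at t)"
  proof (rule global_solution_exists[of "\<lambda>t X. A t o\<^sub>L X" a id_blinfun])
    show "continuous_on UNIV (\<lambda>t. A t o\<^sub>L X t)" if "continuous_on UNIV X" for X :: "real \<Rightarrow> 'a \<Rightarrow>\<^sub>L 'a"
      by (rule bounded_bilinear.continuous_on[OF comp_bil cont that])
    show "norm ((A t o\<^sub>L X) - (A t o\<^sub>L Y)) \<le> a * norm (X - Y)" for t and X Y :: "'a \<Rightarrow>\<^sub>L 'a"
      using comp_le(1)[of t "X - Y"] by (simp add: bounded_bilinear.diff_right[OF comp_bil])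
  qed auto
  obtain V where V0: "V 0 = id_blinfun"
    and V': "\<And>t. (V has_vector_derivative - (V t o\<^sub>L A t)) (at t)"
  proof (rule global_solution_exists[of "\<lambda>t X. - (X o\<^sub>L A t)" a id_blinfun])
    show "continuous_on UNIV (\<lambda>t. - (X t o\<^sub>L A t))" if "continuous_on UNIV X" for X :: "real \<Rightarrow> 'a \<Rightarrow>\<^sub>L 'a"
      by (intro continuous_on_minus bounded_bilinear.continuous_on[OF comp_bil that cont])
    show "norm (- (X o\<^sub>L A t) - - (Y o\<^sub>L A t)) \<le> a * norm (X - Y)" for t and X Y :: "'a \<Rightarrow>\<^sub>L 'a"
      using comp_le(2)[of "Y - X" t]
      by (simp add: bounded_bilinear.diff_left[OF comp_bil] norm_minus_commute)
  qed auto
  have assoc: "(X o\<^sub>L Y) o\<^sub>L Z = X o\<^sub>L (Y o\<^sub>L Z)" for X Y Z :: "'a \<Rightarrow>\<^sub>L 'a"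
    by (rule blinfun_eqI) simp
  have id_comp: "id_blinfun o\<^sub>L X = X" "X o\<^sub>L id_blinfun = X" for X :: "'a \<Rightarrow>\<^sub>L 'a"
    by (rule blinfun_eqI, simp)+
  have VU: "V t o\<^sub>L U t = id_blinfun" for t
  proof -
    have "((\<lambda>t. (V t o\<^sub>L U t) - id_blinfun) has_vector_derivative
        (V t o\<^sub>L (A t o\<^sub>L U t)) + (- (V t o\<^sub>L A t) o\<^sub>L U t) - 0) (at t)" for t
      by (intro derivative_intros bounded_bilinear.has_vector_derivative[OF comp_bil] V' U')
    then have "((\<lambda>t. (V t o\<^sub>L U t) - id_blinfun) has_vector_derivative 0) (at t)" for t
      by (simp add: assoc bounded_bilinear.minus_left[OF comp_bil])
    then have "(V t o\<^sub>L U t) - id_blinfun = 0"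
      by (rule norm_derivative_le_imp_zero[where a = 0]) (auto simp: U0 V0 id_comp)
    then show ?thesis by simp
  qed
  \<comment> \<open>In infinite dimension a left inverse need not be a right inverse, so this
    product needs its own uniqueness argument.\<close>
  have UV: "U t o\<^sub>L V t = id_blinfun" for t
  proof -
    let ?Z = "\<lambda>t. (U t o\<^sub>L V t) - id_blinfun"
    have eq: "(U t o\<^sub>L (- (V t o\<^sub>L A t))) + ((A t o\<^sub>L U t) o\<^sub>L V t) - 0
        = (A t o\<^sub>L ?Z t) - (?Z t o\<^sub>L A t)" for t
      by (simp add: assoc id_comp bounded_bilinear.minus_right[OF comp_bil]
          bounded_bilinear.diff_left[OF comp_bil] bounded_bilinear.diff_right[OF comp_bil])
    have "(?Z has_vector_derivative
        (U t o\<^sub>L (- (V t o\<^sub>L A t))) + ((A t o\<^sub>L U t) o\<^sub>L V t) - 0) (at t)" for t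
      by (intro derivative_intros bounded_bilinear.has_vector_derivative[OF comp_bil] V' U')
    then have "(?Z has_vector_derivative (A t o\<^sub>L ?Z t) - (?Z t o\<^sub>L A t)) (at t)" for t
      unfolding eq .
    moreover have "norm ((A t o\<^sub>L ?Z t) - (?Z t o\<^sub>L A t)) \<le> (2 * a) * norm (?Z t)" for t
      using norm_triangle_ineq4[of "A t o\<^sub>L ?Z t" "?Z t o\<^sub>L A t"] comp_le(1)[of t "?Z t"] comp_le(2)[of "?Z t" t]
      by linarith
    ultimately have "?Z t = 0"
      by (rule norm_derivative_le_imp_zero) (simp add: U0 V0 id_comp)
    then show ?thesis by simp
  qed
  \<comment> \<open>\<open>U\<close> solves the equation in operator norm, while
    \<open>cauchy_op\<close> is described pointwise. Norm differentiability implies the pointwise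
    one, and uniqueness applied to \<open>W t x - U t x\<close> for each \<open>x\<close> identifies
    any other candidate with \<open>U\<close>.\<close>
  have "cauchy_op A = U"
    unfolding cauchy_op_def
  proof (rule the_equality)
    have "((\<lambda>s. blinfun_apply (U s) x) has_vector_derivative blinfun_apply (A t) (blinfun_apply (U t) x)) (at t)"
      for x t
      using bounded_bilinear.has_vector_derivative[OF bounded_bilinear_blinfun_apply U'[of t]
          has_vector_derivative_const[of x]] by simp
    then show "U 0 = id_blinfun \<and> (\<forall>x t. ((\<lambda>s. blinfun_apply (U s) x) has_vector_derivative
        blinfun_apply (A t) (blinfun_apply (U t) x)) (at t))"
      using U0 by blast
    note U_sol = this
    fix W assume W: "W 0 = id_blinfun \<and> (\<forall>x t. ((\<lambda>s. blinfun_apply (W s) x) has_vector_derivative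
        blinfun_apply (A t) (blinfun_apply (W t) x)) (at t))"
    show "W = U"
    proof (intro ext blinfun_eqI)
      fix t x
      have "blinfun_apply (W t) x - blinfun_apply (U t) x = 0"
      proof (rule norm_derivative_le_imp_zero[where x = "\<lambda>t. blinfun_apply (W t) x - blinfun_apply (U t) x"
            and a = a])
        show "((\<lambda>t. blinfun_apply (W t) x - blinfun_apply (U t) x) has_vector_derivative
            blinfun_apply (A t) (blinfun_apply (W t) x - blinfun_apply (U t) x)) (at t)" for t
          unfolding blinfun.diff_right using W U_sol by (intro has_vector_derivative_diff) blast+
        show "norm (blinfun_apply (A t) y) \<le> a * norm y" for t y
          using norm_blinfun[of "A t" y] mult_right_mono[OF bdd[of t] norm_ge_zero[of y]] by linarith
      qed (simp add: W U0)
      then show "blinfun_apply (W t) x = blinfun_apply (U t) x" by simp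
    qed
  qed
  moreover have "inv_blinfun (U t) = V t" for t
    unfolding inv_blinfun_def
  proof (rule the_equality)
    show "V t o\<^sub>L U t = id_blinfun \<and> U t o\<^sub>L V t = id_blinfun" using UV VU by simp
    show "S = V t" if "S o\<^sub>L U t = id_blinfun \<and> U t o\<^sub>L S = id_blinfun" for S
      using that UV[of t] by (metis assoc id_comp)
  qed
  ultimately show "cauchy_op A t o\<^sub>L inv_blinfun (cauchy_op A t) = id_blinfun"
    and "((\<lambda>t. inv_blinfun (cauchy_op A t)) has_vector_derivative
           - (inv_blinfun (cauchy_op A t) o\<^sub>L A t)) (at t)"
    using UV V' by simp_all
qed

section \<open>A priori estimates on finite intervals\<close>

text \<open>Variation of constants with \<open>t\<close> fixed: in the \<sigma>-derivative of
  \<open>transported A T t \<sigma>\<close> applied to \<open>y \<sigma>\<close> the terms with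
  \<open>A\<close> cancel and only \<open>g\<close> remains. Integrating over \<open>[a, t]\<close>
  for \<open>T = R\<close> and over \<open>[t, b]\<close> for \<open>T = id_blinfun - R\<close>,
  each in the direction where the kernel decays, costs \<open>N * G / \<nu>\<close> twice; the
  endpoint values give the exponential terms.\<close>

lemma dichotomy_estimate:
  fixes A :: "real \<Rightarrow> 'a::banach \<Rightarrow>\<^sub>L 'a"
  assumes cont: "continuous_on UNIV A" and bdd: "\<And>t. norm (A t) \<le> k"
    and stable: "\<And>t \<tau>. a \<le> \<tau> \<Longrightarrow> \<tau> \<le> t \<Longrightarrow> t \<le> b \<Longrightarrow>
      norm (transported A R t \<tau>) \<le> N * exp (- \<nu> * (t - \<tau>))"
    and unstable: "\<And>t \<tau>. a \<le> t \<Longrightarrow> t \<le> \<tau> \<Longrightarrow> \<tau> \<le> b \<Longrightarrow>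
      norm (transported A (id_blinfun - R) t \<tau>) \<le> N * exp (- \<nu> * (\<tau> - t))"
    and nonneg: "0 \<le> N" "0 < \<nu>" "0 \<le> G"
    and deriv: "\<And>\<sigma>. a \<le> \<sigma> \<Longrightarrow> \<sigma> \<le> b \<Longrightarrow>
      (y has_vector_derivative blinfun_apply (A \<sigma>) (y \<sigma>) + g \<sigma>) (at \<sigma>)"
    and g_le: "\<And>\<sigma>. a \<le> \<sigma> \<Longrightarrow> \<sigma> \<le> b \<Longrightarrow> norm (g \<sigma>) \<le> G"
    and ends: "norm (y a) \<le> M" "norm (y b) \<le> M"
    and t: "a \<le> t" "t \<le> b"
  shows "norm (y t) \<le> N * M * (exp (- \<nu> * (t - a)) + exp (- \<nu> * (b - t))) + 2 * N * G / \<nu>"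
proof -
  let ?S = "\<lambda>T \<sigma>. blinfun_apply (transported A T t \<sigma>) (y \<sigma>)"
  have S': "(?S T has_vector_derivative blinfun_apply (transported A T t \<sigma>) (g \<sigma>)) (at \<sigma>)"
    if \<sigma>: "a \<le> \<sigma>" "\<sigma> \<le> b" for T \<sigma>
  proof -
    have "((\<lambda>\<sigma>. transported A T t \<sigma>) has_vector_derivative
        ((cauchy_op A t o\<^sub>L T) o\<^sub>L - (inv_blinfun (cauchy_op A \<sigma>) o\<^sub>L A \<sigma>))
        + (0 o\<^sub>L inv_blinfun (cauchy_op A \<sigma>))) (at \<sigma>)"
      unfolding transported_def
      by (intro bounded_bilinear.has_vector_derivative[OF bounded_bilinear_blinfun_compose]
          has_vector_derivative_const cauchy_op_properties(2)[OF cont bdd])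
    from bounded_bilinear.has_vector_derivative[OF bounded_bilinear_blinfun_apply this deriv[OF \<sigma>]]
    show ?thesis
      by (simp add: transported_def blinfun.bilinear_simps)
  qed
  have S_cont: "continuous_on {c..d} (?S T)" if "a \<le> c" "d \<le> b" for c d T
    by (intro continuous_at_imp_continuous_on)
      (use that has_vector_derivative_continuous[OF S'] in force)
  have S_g: "norm (blinfun_apply X (g \<sigma>)) \<le> N * G * e"
    if "norm X \<le> N * e" "a \<le> \<sigma>" "\<sigma> \<le> b" for X :: "'a \<Rightarrow>\<^sub>L 'a" and \<sigma> e
  proof -
    have "norm (blinfun_apply X (g \<sigma>)) \<le> norm X * norm (g \<sigma>)" by (rule norm_blinfun)
    also have "\<dots> \<le> (N * e) * G"
      using that g_le[of \<sigma>] order.trans[OF norm_ge_zero that(1)] by (intro mult_mono) auto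
    finally show ?thesis by (simp add: mult_ac)
  qed
  have S_y: "norm (blinfun_apply X z) \<le> N * M * e"
    if "norm X \<le> N * e" "norm z \<le> M" for X :: "'a \<Rightarrow>\<^sub>L 'a" and z e
  proof -
    have "norm (blinfun_apply X z) \<le> norm X * norm z" by (rule norm_blinfun)
    also have "\<dots> \<le> (N * e) * M"
      using that order.trans[OF norm_ge_zero that(1)] by (intro mult_mono) auto
    finally show ?thesis by (simp add: mult_ac)
  qed
  have "norm (?S R t - ?S R a) \<le> N * G / \<nu>"
  proof (cases "a < t")
    case True
    \<comment> \<open>An antiderivative of the bound on the integrand; its nonnegative value at
      \<open>a\<close> is dropped.\<close>
    let ?p = "\<lambda>\<sigma>. N * G / \<nu> * exp (- \<nu> * (t - \<sigma>))"
    have "norm (?S R t - ?S R a) \<le> ?p t - ?p a"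
    proof (rule differentiable_bound_general[OF True])
      show "(?S R has_vector_derivative blinfun_apply (transported A R t \<sigma>) (g \<sigma>)) (at \<sigma>)"
        if "a < \<sigma>" "\<sigma> < t" for \<sigma>
        using that t by (intro S') auto
      show "norm (blinfun_apply (transported A R t \<sigma>) (g \<sigma>)) \<le> N * G * exp (- \<nu> * (t - \<sigma>))"
        if "a < \<sigma>" "\<sigma> < t" for \<sigma>
        using that t by (intro S_g stable) auto
      show "(?p has_vector_derivative N * G * exp (- \<nu> * (t - \<sigma>))) (at \<sigma>)" for \<sigma>
        unfolding has_real_derivative_iff_has_vector_derivative[symmetric]
        using nonneg by (auto intro!: derivative_eq_intros)
      show "continuous_on {a..t} (?S R)"
        using t by (intro S_cont) auto
      show "continuous_on {a..t} ?p"
        by (intro continuous_intros)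
    qed
    also have "\<dots> \<le> ?p t" using nonneg by simp
    finally show ?thesis by simp
  qed (use nonneg t in auto)
  moreover have "norm (?S (id_blinfun - R) b - ?S (id_blinfun - R) t) \<le> N * G / \<nu>"
  proof (cases "t < b")
    case True
    \<comment> \<open>The minus sign makes this an increasing antiderivative; its value at
      \<open>b\<close> is at most 0 and is dropped.\<close>
    let ?p = "\<lambda>\<sigma>. - (N * G / \<nu> * exp (- \<nu> * (\<sigma> - t)))"
    have "norm (?S (id_blinfun - R) b - ?S (id_blinfun - R) t) \<le> ?p b - ?p t"
    proof (rule differentiable_bound_general[OF True])
      show "(?S (id_blinfun - R) has_vector_derivative
          blinfun_apply (transported A (id_blinfun - R) t \<sigma>) (g \<sigma>)) (at \<sigma>)"
        if "t < \<sigma>" "\<sigma> < b" for \<sigma>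
        using that t by (intro S') auto
      show "norm (blinfun_apply (transported A (id_blinfun - R) t \<sigma>) (g \<sigma>))
          \<le> N * G * exp (- \<nu> * (\<sigma> - t))"
        if "t < \<sigma>" "\<sigma> < b" for \<sigma>
        using that t by (intro S_g unstable) auto
      show "(?p has_vector_derivative N * G * exp (- \<nu> * (\<sigma> - t))) (at \<sigma>)" for \<sigma>
        unfolding has_real_derivative_iff_has_vector_derivative[symmetric]
        using nonneg by (auto intro!: derivative_eq_intros)
      show "continuous_on {t..b} (?S (id_blinfun - R))"
        using t by (intro S_cont) auto
      show "continuous_on {t..b} ?p"
        by (intro continuous_intros)
    qed
    also have "\<dots> \<le> - ?p t" using nonneg by simp
    finally show ?thesis by simp
  qed (use nonneg t in auto)
  moreover have "norm (?S R a) \<le> N * M * exp (- \<nu> * (t - a))"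
    using t by (intro S_y stable ends) auto
  moreover have "norm (?S (id_blinfun - R) b) \<le> N * M * exp (- \<nu> * (b - t))"
    using t by (intro S_y unstable ends) auto
  \<comment> \<open>At \<sigma> = \<open>t\<close> the complementary projections add up to the
    identity, so the two parts sum to \<open>y t\<close>.\<close>
  moreover have "norm (y t) \<le> norm (?S R t) + norm (?S (id_blinfun - R) t)"
  proof -
    have "?S R t + ?S (id_blinfun - R) t
        = blinfun_apply (cauchy_op A t o\<^sub>L inv_blinfun (cauchy_op A t)) (y t)"
      by (simp add: transported_def blinfun.bilinear_simps)
    then have "?S R t + ?S (id_blinfun - R) t = y t"
      using cauchy_op_properties(1)[OF cont bdd] by simp
    then show ?thesis by (metis norm_triangle_ineq)
  qed
  moreover have "N * M * (exp (- \<nu> * (t - a)) + exp (- \<nu> * (b - t))) + 2 * N * G / \<nu>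
      = N * M * exp (- \<nu> * (t - a)) + N * M * exp (- \<nu> * (b - t)) + N * G / \<nu> + N * G / \<nu>"
    by (simp add: algebra_simps)
  ultimately show ?thesis
    using norm_triangle_sub[of "?S R t" "?S R a"]
      norm_triangle_sub[of "?S (id_blinfun - R) t" "?S (id_blinfun - R) b"]
      norm_minus_commute[of "?S (id_blinfun - R) t" "?S (id_blinfun - R) b"]
    by linarith
qed

text \<open>Each application of \<open>step\<close> shrinks the radius by \<open>h\<close> and
  replaces a bound \<open>c\<close> by \<open>\<delta> + q * c\<close>. This affine map has the
  fixed point \<open>\<delta> / (1 - q)\<close>, and the excess over it is multiplied by
  \<open>q\<close> each time.\<close>

lemma bound_by_nested_intervals:
  fixes w :: "real \<Rightarrow> 'a::real_normed_vector"
  assumes bound: "\<And>t. norm (w t) \<le> M"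
    and step: "\<And>r c t. r + h \<le> l \<Longrightarrow> (\<And>s. \<bar>s\<bar> \<le> r + h \<Longrightarrow> norm (w s) \<le> c) \<Longrightarrow> \<bar>t\<bar> \<le> r
      \<Longrightarrow> norm (w t) \<le> \<delta> + q * c"
    and "0 \<le> \<delta>" "q < 1" "0 \<le> h"
    and "\<bar>t\<bar> \<le> l - real k * h"
  shows "norm (w t) \<le> \<delta> / (1 - q) + q ^ k * M"
  using \<open>\<bar>t\<bar> \<le> l - real k * h\<close>
proof (induction k arbitrary: t)
  case 0
  have "0 \<le> \<delta> / (1 - q)" using assms by simp
  then show ?case using bound[of t] by simp
next
  case (Suc k)
  have "norm (w t) \<le> \<delta> + q * (\<delta> / (1 - q) + q ^ k * M)"
  proof (rule step[of "l - real (Suc k) * h"])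
    show "l - real (Suc k) * h + h \<le> l" using \<open>0 \<le> h\<close> by (simp add: algebra_simps)
    show "norm (w s) \<le> \<delta> / (1 - q) + q ^ k * M" if "\<bar>s\<bar> \<le> l - real (Suc k) * h + h" for s
      using that by (intro Suc.IH) (simp add: algebra_simps)
  qed (fact Suc.prems)
  also have "\<delta> + q * (\<delta> / (1 - q) + q ^ k * M) = \<delta> / (1 - q) + q ^ Suc k * M"
    using \<open>q < 1\<close> by (simp add: field_simps)
  finally show ?case .
qed

section \<open>The function space topologies\<close>

text \<open>Convergence can be tested on a subbasis, because eventual membership passes to finite
  intersections and arbitrary unions.\<close>

lemma limitin_topology_generated_by:
  assumes "l \<in> \<Union>\<S>"
    and basis: "\<And>U. U \<in> \<S> \<Longrightarrow> l \<in> U \<Longrightarrow> eventually (\<lambda>n. g n \<in> U) \<F>"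
  shows "limitin (topology_generated_by \<S>) g l \<F>"
  unfolding limitin_def
proof (intro conjI allI impI)
  show "l \<in> topspace (topology_generated_by \<S>)" using assms(1) by simp
  fix U assume U: "openin (topology_generated_by \<S>) U \<and> l \<in> U"
  then have "generate_topology_on \<S> U" "l \<in> U"
    by (auto simp: openin_topology_generated_by_iff)
  then show "eventually (\<lambda>n. g n \<in> U) \<F>"
  proof induction
    case (UN K)
    then obtain k where k: "k \<in> K" "l \<in> k" by blast
    then have "eventually (\<lambda>n. g n \<in> k) \<F>" by (rule UN.IH)
    then show ?case by eventually_elim (use k in blast)
  qed (use basis in \<open>auto intro: eventually_conj\<close>)
qed

section \<open>Uniform convergence on compact sets\<close>

lemma cts_on_UNIV_iff: "g \<in> cts_on UNIV \<longleftrightarrow> continuous_on UNIV g"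
  by (simp add: cts_on_def extensional_def)

lemma openin_unif_compact_ball:
  assumes "continuous_on UNIV f" "compact K" "0 < e"
  shows "openin unif_compact_topology {g \<in> cts_on UNIV. \<forall>t\<in>K. dist (f t) (g t) < e}"
  unfolding unif_compact_topology_def
  by (rule topology_generated_by_Basis) (use assms in \<open>auto simp: cts_on_UNIV_iff\<close>)

lemma topspace_unif_compact:
  "topspace (unif_compact_topology :: (real \<Rightarrow> 'b::metric_space) topology) = cts_on UNIV"
proof
  show "topspace unif_compact_topology \<subseteq> (cts_on UNIV :: (real \<Rightarrow> 'b) set)"
    unfolding unif_compact_topology_def by auto
  show "(cts_on UNIV :: (real \<Rightarrow> 'b) set) \<subseteq> topspace unif_compact_topology"
  proof
    fix g :: "real \<Rightarrow> 'b" assume "g \<in> cts_on UNIV"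
    then show "g \<in> topspace unif_compact_topology"
      \<comment> \<open>With the empty compact set the distance condition is vacuous, so the
        subbasic set is the whole space.\<close>
      using openin_subset[OF openin_unif_compact_ball[of g "{}" 1]] by (auto simp: cts_on_UNIV_iff)
  qed
qed

text \<open>The subbasic sets centred at the limit itself express uniform convergence on
  \<open>K\<close>.\<close>

lemma converges_in_unif_compact_imp_uniformly_Cauchy:
  assumes "converges_in unif_compact_topology g" "compact K"
  shows "uniformly_Cauchy_on K g"
proof -
  obtain l where l: "limitin unif_compact_topology g l sequentially"
    using assms by (auto simp: converges_in_def)
  then have cont: "continuous_on UNIV l"
    by (simp add: limitin_def topspace_unif_compact cts_on_UNIV_iff)
  have "uniform_limit K g l sequentially"
    unfolding uniform_limit_iff
  proof (intro allI impI)
    fix e :: real assume "e > 0"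
    let ?U = "{g \<in> cts_on UNIV. \<forall>t\<in>K. dist (l t) (g t) < e}"
    have "openin unif_compact_topology ?U"
      using cont assms(2) \<open>e > 0\<close> by (rule openin_unif_compact_ball)
    moreover have "l \<in> ?U" using cont \<open>e > 0\<close> by (simp add: cts_on_UNIV_iff)
    ultimately have "eventually (\<lambda>n. g n \<in> ?U) sequentially"
      using l unfolding limitin_def by blast
    then show "\<forall>\<^sub>F n in sequentially. \<forall>x\<in>K. dist (g n x) (l x) < e"
      by eventually_elim (simp add: dist_commute)
  qed
  then show ?thesis
    using uniformly_convergent_Cauchy uniformly_convergent_on_def by blast
qed

text \<open>Completeness of the target gives a pointwise limit, with which the uniform limits on all
  compact sets agree. It is continuous because each point has a neighbourhood inside a compact
  ball.\<close>

lemma uniformly_Cauchy_imp_converges_in_unif_compact: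
  fixes g :: "nat \<Rightarrow> real \<Rightarrow> 'b::complete_space"
  assumes cont: "\<And>n. continuous_on UNIV (g n)"
    and Cauchy: "\<And>K. compact K \<Longrightarrow> uniformly_Cauchy_on K g"
  shows "converges_in unif_compact_topology g"
proof -
  have "Cauchy (\<lambda>n. g n t)" for t
    using uniformly_Cauchy_imp_Cauchy[OF Cauchy[of "{t}"]] by simp
  then have lim: "(\<lambda>n. g n t) \<longlonglongrightarrow> lim (\<lambda>n. g n t)" for t
    by (simp add: Cauchy_convergent_iff convergent_LIMSEQ_iff)
  define l where "l t = lim (\<lambda>n. g n t)" for t
  have unif: "uniform_limit K g l sequentially" if K: "compact K" for K
  proof -
    obtain l' where l': "uniform_limit K g l' sequentially"
      using Cauchy_uniformly_convergent[OF Cauchy[OF K]] by (auto simp: uniformly_convergent_on_def)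
    have "l' t = l t" if "t \<in> K" for t
      using LIMSEQ_unique[OF tendsto_uniform_limitI[OF l' that]] lim l_def by auto
    then show ?thesis
      using uniform_limit_cong'[of K g g l' l] l' by simp
  qed
  have "isCont l t" for t
  proof -
    have "continuous_on (ball t 1) l"
    proof (rule uniform_limit_theorem)
      show "uniform_limit (ball t 1) g l sequentially"
        using unif[of "cball t 1"] by (rule uniform_limit_on_subset) auto
      show "\<forall>\<^sub>F n in sequentially. continuous_on (ball t 1) (g n)"
        using continuous_on_subset[OF cont] by simp
    qed simp
    then show ?thesis by (auto simp: continuous_on_eq_continuous_at)
  qed
  then have l_cont: "continuous_on UNIV l"
    by (simp add: continuous_at_imp_continuous_on)
  have "limitin unif_compact_topology g l sequentially"
    unfolding unif_compact_topology_def
  proof (rule limitin_topology_generated_by)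
    have "l \<in> topspace unif_compact_topology"
      using l_cont by (simp add: topspace_unif_compact cts_on_UNIV_iff)
    then show "l \<in> \<Union>{{g \<in> cts_on UNIV. \<forall>t\<in>K. dist (f t) (g t) < e} | f K e.
        f \<in> cts_on UNIV \<and> compact K \<and> 0 < e}"
      unfolding unif_compact_topology_def topology_generated_by_topspace .
    fix U assume "U \<in> {{g \<in> cts_on UNIV. \<forall>t\<in>K. dist (f t) (g t) < e} | f K e.
        f \<in> cts_on UNIV \<and> compact K \<and> (0::real) < e}" and "l \<in> U"
    then obtain f K and e :: real where U: "U = {g \<in> cts_on UNIV. \<forall>t\<in>K. dist (f t) (g t) < e}"
      and f: "continuous_on UNIV f" and K: "compact K"
      and l: "\<forall>t\<in>K. dist (f t) (l t) < e"
      by (auto simp: cts_on_UNIV_iff)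
    \<comment> \<open>A subbasic set around \<open>l\<close> may be centred at another function
      \<open>f\<close>. Since the distance attains its maximum on \<open>K\<close>, there is a
      uniform margin \<open>d\<close> by which \<open>l\<close> may be perturbed.\<close>
    have "\<exists>d>0. \<forall>t\<in>K. dist (f t) (l t) + d \<le> e"
    proof (cases "K = {}")
      case False
      have "continuous_on K (\<lambda>t. dist (f t) (l t))"
        by (intro continuous_on_dist continuous_on_subset[OF f] continuous_on_subset[OF l_cont]) auto
      then obtain t0 where t0: "t0 \<in> K" "\<And>t. t \<in> K \<Longrightarrow> dist (f t) (l t) \<le> dist (f t0) (l t0)"
        using continuous_attains_sup[OF K False] by blast
      then show ?thesis
        using l by (intro exI[of _ "e - dist (f t0) (l t0)"]) auto
    qed (auto intro: exI[of _ 1])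
    then obtain d where d: "d > 0" "\<And>t. t \<in> K \<Longrightarrow> dist (f t) (l t) + d \<le> e" by blast
    have "\<forall>\<^sub>F n in sequentially. \<forall>t\<in>K. dist (g n t) (l t) < d"
      using unif[OF K] d(1) by (simp add: uniform_limit_iff)
    then show "\<forall>\<^sub>F n in sequentially. g n \<in> U"
    proof eventually_elim
      case (elim n)
      have "dist (f t) (g n t) < e" if "t \<in> K" for t
        using dist_triangle2[of "f t" "g n t" "l t"] elim d(2)[of t] that by force
      then show ?case by (simp add: U cts_on_UNIV_iff cont)
    qed
  qed
  then show ?thesis by (auto simp: converges_in_def)
qed

text \<open>Evaluation at 0 is continuous on the function space and sends the translate by
  \<open>h\<close> to \<open>g h\<close>. The image of the compact closure of the translates is
  therefore a compact set containing the range.\<close>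

lemma lagrange_stable_imp_compact_closure_range:
  assumes "lagrange_stable g"
  shows "compact (closure (range g))"
proof -
  let ?X = "unif_compact_topology :: (real \<Rightarrow> 'a) topology"
  have "continuous_map ?X euclidean (\<lambda>g. g 0)"
    unfolding continuous_map_def
  proof (intro conjI allI impI)
    fix V :: "'a set" assume "openin euclidean V"
    then have "open V" by simp
    show "openin ?X {f \<in> topspace ?X. f 0 \<in> V}"
    proof (subst openin_subopen, intro ballI)
      fix f assume f: "f \<in> {f \<in> topspace ?X. f 0 \<in> V}"
      then obtain e where e: "e > 0" "ball (f 0) e \<subseteq> V"
        using \<open>open V\<close> open_contains_ball by blast
      let ?B = "{g \<in> cts_on UNIV. \<forall>t\<in>{0}. dist (f t) (g t) < e}"
      have "openin ?X ?B"
        using f e by (intro openin_unif_compact_ball) (auto simp: topspace_unif_compact cts_on_UNIV_iff)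
      moreover have "f \<in> ?B" "?B \<subseteq> {f \<in> topspace ?X. f 0 \<in> V}"
        using f e by (auto simp: topspace_unif_compact)
      ultimately show "\<exists>T. openin ?X T \<and> f \<in> T \<and> T \<subseteq> {f \<in> topspace ?X. f 0 \<in> V}"
        by blast
    qed
  qed auto
  moreover let ?C = "?X closure_of range (\<lambda>h. shift h g)"
  have C: "compactin ?X ?C" "range (\<lambda>h. shift h g) \<subseteq> topspace ?X"
    using assms by (auto simp: lagrange_stable_def precompact_in_def)
  ultimately have "compact ((\<lambda>g. g 0) ` ?C)"
    using image_compactin by fastforce
  moreover have "range g \<subseteq> (\<lambda>g. g 0) ` ?C"
  proof
    fix y assume "y \<in> range g"
    then obtain h where "y = shift h g 0" by (auto simp: shift_def)
    moreover have "shift h g \<in> ?C" using closure_of_subset[OF C(2)] by auto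
    ultimately show "y \<in> (\<lambda>g. g 0) ` ?C" by blast
  qed
  ultimately show ?thesis
    by (metis bounded_subset closed_closure closure_minimal compact_imp_bounded compact_imp_closed
        compact_Int_closed inf.absorb2)
qed

section \<open>The compact-open topology\<close>

text \<open>By uniform continuity of the limit, \<open>K\<close> splits into finitely many small
  compact pieces, each mapped by the limit into a small ball. These are finitely many subbasic
  conditions, and together they force uniform closeness on \<open>K\<close>.\<close>

lemma converges_in_compact_open_imp_uniformly_Cauchy:
  fixes g :: "nat \<Rightarrow> 'a::metric_space \<Rightarrow> 'b::metric_space"
  assumes "converges_in (compact_open_topology S) g" and K: "compact K" "K \<subseteq> S"
  shows "uniformly_Cauchy_on K g"
proof -
  obtain l where l: "limitin (compact_open_topology S) g l sequentially"
    using assms by (auto simp: converges_in_def)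
  then have l_cts: "l \<in> cts_on S"
    by (auto simp: limitin_def compact_open_topology_def)
  then have cont: "continuous_on K l"
    using K by (auto simp: cts_on_def intro: continuous_on_subset)
  have "uniform_limit K g l sequentially"
    unfolding uniform_limit_iff
  proof (intro allI impI)
    fix e :: real assume e: "e > 0"
    have "uniformly_continuous_on K l"
      using cont K(1) by (rule compact_uniformly_continuous)
    then obtain d where d: "d > 0"
      "\<And>x y. x \<in> K \<Longrightarrow> y \<in> K \<Longrightarrow> dist y x < d \<Longrightarrow> dist (l y) (l x) < e / 2"
      using e unfolding uniformly_continuous_on_def by (metis half_gt_zero)
    have "K \<subseteq> (\<Union>x\<in>K. ball x (d / 2))" using d by auto
    then obtain T where T: "T \<subseteq> K" "finite T" "K \<subseteq> (\<Union>x\<in>T. ball x (d / 2))"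
      using compactE_image[OF K(1), of K "\<lambda>x. ball x (d / 2)"] by auto
    \<comment> \<open>Radius \<open>d / 2\<close> keeps even the closed ball inside the range where
      \<open>l\<close> varies by less than \<open>e / 2\<close>; closedness makes the piece
      compact.\<close>
    have "\<forall>\<^sub>F n in sequentially. g n ` (K \<inter> cball x (d / 2)) \<subseteq> ball (l x) (e / 2)" if "x \<in> T" for x
    proof -
      let ?U = "{g \<in> cts_on S. g ` (K \<inter> cball x (d / 2)) \<subseteq> ball (l x) (e / 2)}"
      have "openin (compact_open_topology S) ?U"
        unfolding compact_open_topology_def
        by (rule topology_generated_by_Basis) (use K in \<open>blast intro: compact_Int_closed\<close>)
      moreover have "l \<in> ?U"
        using l_cts d that T(1) by (force simp: dist_commute)
      ultimately have "\<forall>\<^sub>F n in sequentially. g n \<in> ?U"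
        using l by (auto simp: limitin_def)
      then show ?thesis by eventually_elim auto
    qed
    then have "\<forall>\<^sub>F n in sequentially. \<forall>x\<in>T. g n ` (K \<inter> cball x (d / 2)) \<subseteq> ball (l x) (e / 2)"
      using T(2) by (simp add: eventually_ball_finite)
    then show "\<forall>\<^sub>F n in sequentially. \<forall>x\<in>K. dist (g n x) (l x) < e"
    proof eventually_elim
      case (elim n)
      show ?case
      proof
        fix x assume x: "x \<in> K"
        then obtain z where z: "z \<in> T" "dist z x < d / 2" using T(3) by auto
        have "g n x \<in> ball (l z) (e / 2)" using elim z x by force
        moreover have "dist (l x) (l z) < e / 2"
          using d(2)[of z x] x z T(1) d(1) by (auto simp: dist_commute)
        ultimately show "dist (g n x) (l x) < e"
          using dist_triangle2[of "g n x" "l x" "l z"] by (simp add: dist_commute)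
      qed
    qed
  qed
  then show ?thesis
    using uniformly_convergent_Cauchy uniformly_convergent_on_def by blast
qed

section \<open>Remote compatibility\<close>

lemma shift2_restrict: "x \<in> K \<Longrightarrow> shift2 h (restrict F (UNIV \<times> K)) (t, x) = F (t + h, x)"
  by (simp add: shift2_def)

text \<open>The window of radius \<open>l\<close> around \<open>s n\<close> eventually lies in one
  half-line, where the trichotomy is an ordinary dichotomy: stable projection \<open>P\<close> on
  the right, \<open>id_blinfun - Q\<close> on the left. \<open>R\<close> is chosen before
  \<open>l\<close> and so serves all windows.\<close>

lemma trichotomy_imp_dichotomy_near_infinity:
  assumes tri: "exponential_trichotomy A P Q N \<nu>" and s: "to_infinity s"
  obtains R where "\<And>l. \<forall>\<^sub>F n in sequentially. \<forall>t \<tau>. s n - l \<le> t \<longrightarrow> t \<le> s n + l \<longrightarrow>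
      s n - l \<le> \<tau> \<longrightarrow> \<tau> \<le> s n + l \<longrightarrow>
      (\<tau> \<le> t \<longrightarrow> norm (transported A R t \<tau>) \<le> N * exp (- \<nu> * (t - \<tau>))) \<and>
      (t \<le> \<tau> \<longrightarrow> norm (transported A (id_blinfun - R) t \<tau>) \<le> N * exp (- \<nu> * (\<tau> - t)))"
proof -
  from s consider "filterlim s at_top sequentially" | "filterlim s at_bot sequentially"
    by (auto simp: to_infinity_def)
  then show thesis
  proof cases
    case 1
    show thesis
    proof (rule that[of P])
      fix l
      have "\<forall>\<^sub>F n in sequentially. l \<le> s n"
        using 1 by (simp add: filterlim_at_top)
      then show "\<forall>\<^sub>F n in sequentially. \<forall>t \<tau>. s n - l \<le> t \<longrightarrow> t \<le> s n + l \<longrightarrow>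
          s n - l \<le> \<tau> \<longrightarrow> \<tau> \<le> s n + l \<longrightarrow>
          (\<tau> \<le> t \<longrightarrow> norm (transported A P t \<tau>) \<le> N * exp (- \<nu> * (t - \<tau>))) \<and>
          (t \<le> \<tau> \<longrightarrow> norm (transported A (id_blinfun - P) t \<tau>) \<le> N * exp (- \<nu> * (\<tau> - t)))"
        by eventually_elim (use tri in \<open>auto simp: exponential_trichotomy_def\<close>)
    qed
  next
    case 2
    have Q: "id_blinfun - (id_blinfun - Q) = Q" by simp
    show thesis
    proof (rule that[of "id_blinfun - Q"])
      fix l
      have "\<forall>\<^sub>F n in sequentially. s n \<le> - l"
        using 2 by (simp add: filterlim_at_bot)
      then show "\<forall>\<^sub>F n in sequentially. \<forall>t \<tau>. s n - l \<le> t \<longrightarrow> t \<le> s n + l \<longrightarrow>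
          s n - l \<le> \<tau> \<longrightarrow> \<tau> \<le> s n + l \<longrightarrow>
          (\<tau> \<le> t \<longrightarrow> norm (transported A (id_blinfun - Q) t \<tau>) \<le> N * exp (- \<nu> * (t - \<tau>))) \<and>
          (t \<le> \<tau> \<longrightarrow> norm (transported A (id_blinfun - (id_blinfun - Q)) t \<tau>)
             \<le> N * exp (- \<nu> * (\<tau> - t)))"
        unfolding Q
        by eventually_elim (use tri in \<open>auto simp: exponential_trichotomy_def\<close>)
    qed
  qed
qed

lemma small_exp_exists:
  fixes \<nu> C \<delta> :: real
  assumes "0 < \<nu>" "0 < \<delta>"
  obtains h where "0 \<le> h" "C * exp (- \<nu> * h) \<le> \<delta>"
proof -
  have "((\<lambda>h. C * exp (- \<nu> * h)) \<longlongrightarrow> C * 0) at_top"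
    by (intro tendsto_mult tendsto_const filterlim_compose[OF exp_at_bot]
        filterlim_tendsto_neg_mult_at_bot[OF tendsto_const]) (use assms in \<open>auto simp: filterlim_ident\<close>)
  then have "\<forall>\<^sub>F h in at_top. C * exp (- \<nu> * h) < \<delta>"
    using assms by (intro order_tendstoD) auto
  then have "\<forall>\<^sub>F h in at_top. 0 \<le> h \<and> C * exp (- \<nu> * h) \<le> \<delta>"
    using eventually_ge_at_top[of 0] by eventually_elim auto
  then show thesis using that by (auto dest: eventually_happens)
qed

theorem theorem6p21:
  fixes A :: "real \<Rightarrow> 'a::banach \<Rightarrow>\<^sub>L 'a"
    and P Q :: "'a \<Rightarrow>\<^sub>L 'a"
    and f \<phi> :: "real \<Rightarrow> 'a"
    and F :: "real \<times> 'a \<Rightarrow> 'a"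
    and N \<nu> L :: real
  assumes "continuous_on UNIV A"
    and "continuous_on UNIV f"
    and "continuous_on UNIV F"
    and "\<And>t. F (t, 0) = 0"
    and "exponential_trichotomy A P Q N \<nu>"
    and "lagrange_stable A"
    and "lagrange_stable f"
    and "lagrange_stable2 F"
    and "\<And>t u v. norm (F (t, u) - F (t, v)) \<le> L * norm (u - v)"
    and "L < \<nu> / (2 * N)"
    and "compact (closure (range (\<lambda>t. transported A P t t)))"
    and "lagrange_stable \<phi>"
    and "\<And>t. (\<phi> has_vector_derivative (blinfun_apply (A t) (\<phi> t) + f t + F (t, \<phi> t))) (at t)"
    and "\<And>t. ((\<lambda>\<tau>. blinfun_apply (green A P Q t \<tau>) (f \<tau> + F (\<tau>, \<phi> \<tau>)))
               has_integral \<phi> t) UNIV"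
  shows "limit_seqs_AfF A f (closure (range \<phi>))
           (restrict F (UNIV \<times> closure (range \<phi>))) \<subseteq> limit_seqs \<phi>"
proof
  let ?K = "closure (range \<phi>)"
  fix s assume "s \<in> limit_seqs_AfF A f ?K (restrict F (UNIV \<times> ?K))"
  then have s: "to_infinity s"
    and conv_A: "converges_in unif_compact_topology (\<lambda>n. shift (s n) A)"
    and conv_f: "converges_in unif_compact_topology (\<lambda>n. shift (s n) f)"
    and conv_F: "converges_in (compact_open_topology (UNIV \<times> ?K))
                   (\<lambda>n. shift2 (s n) (restrict F (UNIV \<times> ?K)))"
    by (auto simp: limit_seqs_AfF_def)
  have N: "N \<ge> 1" and \<nu>: "\<nu> > 0"
    using assms(5) by (auto simp: exponential_trichotomy_def)
  have K: "compact ?K" by (rule lagrange_stable_imp_compact_closure_range[OF assms(12)])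
  then obtain B where B: "B > 0" "\<And>t. norm (\<phi> t) \<le> B"
    using compact_imp_bounded[OF K] by (metis bounded_pos closure_subset range_subsetD subsetD)
  obtain a where a: "\<And>t. norm (A t) \<le> a"
    using compact_imp_bounded[OF lagrange_stable_imp_compact_closure_range[OF assms(6)]]
    by (metis bounded_pos closure_subset range_subsetD)
  \<comment> \<open>The sign of \<open>L\<close> is not prescribed; \<open>L'\<close> is a
    nonnegative Lipschitz constant below the same threshold.\<close>
  define L' where "L' = max L 0"
  have L': "L' \<ge> 0" "L' < \<nu> / (2 * N)"
    using assms(10) N \<nu> by (auto simp: L'_def)
  have lip: "norm (F (t, u) - F (t, v)) \<le> L' * norm (u - v)" for t u v
    using assms(9)[of t u v] mult_right_mono[of L L' "norm (u - v)"] by (simp add: L'_def)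
  \<comment> \<open>The contraction factor: the term \<open>2 * N * G / \<nu>\<close> of
    \<open>dichotomy_estimate\<close> with the Lipschitz part \<open>L' * c\<close> of the forcing
    inserted for \<open>G\<close>.\<close>
  define q where "q = 2 * N * L' / \<nu>"
  have q: "0 \<le> q" "q < 1"
    using L' N \<nu> by (auto simp: q_def field_simps)
  obtain R where dich: "\<And>l. \<forall>\<^sub>F n in sequentially. \<forall>t \<tau>. s n - l \<le> t \<longrightarrow> t \<le> s n + l \<longrightarrow>
      s n - l \<le> \<tau> \<longrightarrow> \<tau> \<le> s n + l \<longrightarrow>
      (\<tau> \<le> t \<longrightarrow> norm (transported A R t \<tau>) \<le> N * exp (- \<nu> * (t - \<tau>))) \<and>
      (t \<le> \<tau> \<longrightarrow> norm (transported A (id_blinfun - R) t \<tau>) \<le> N * exp (- \<nu> * (\<tau> - t)))"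
    using trichotomy_imp_dichotomy_near_infinity[OF assms(5) s] by blast
  have "uniformly_Cauchy_on C (\<lambda>n. shift (s n) \<phi>)" if C: "compact C" for C
  proof (rule uniformly_Cauchy_onI)
    fix e :: real assume e: "e > 0"
    obtain r where r: "\<And>t. t \<in> C \<Longrightarrow> \<bar>t\<bar> \<le> r"
      using compact_imp_bounded[OF C] by (auto simp: bounded_real)
    \<comment> \<open>Chosen so that \<open>\<delta> / (1 - q) = e / 4\<close>; together with the
      choice of \<open>k\<close> the final bound stays below \<open>e / 2\<close>.\<close>
    define \<delta> where "\<delta> = e * (1 - q) / 4"
    have \<delta>: "\<delta> > 0" using e q by (simp add: \<delta>_def)
    have "(\<lambda>k. q ^ k * (2 * B)) \<longlonglongrightarrow> 0 * (2 * B)"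
      using q by (intro tendsto_mult LIMSEQ_power_zero tendsto_const) auto
    then have "\<forall>\<^sub>F k in sequentially. q ^ k * (2 * B) < e / 4"
      using e by (intro order_tendstoD) auto
    then obtain k where k: "q ^ k * (2 * B) < e / 4"
      by (auto simp: eventually_sequentially)
    obtain h where h: "0 \<le> h" "4 * N * B * exp (- \<nu> * h) \<le> \<delta> / 2"
      using small_exp_exists[OF \<nu>, of "\<delta> / 2" "4 * N * B"] \<delta> by auto
    \<comment> \<open>After \<open>k\<close> steps, each losing \<open>h\<close>, the remaining
      radius \<open>r\<close> still covers \<open>C\<close>.\<close>
    define l where "l = r + real k * h"
    \<comment> \<open>The forcing error \<epsilon> is shared equally between \<open>A\<close>,
      \<open>f\<close> and \<open>F\<close>; the share of \<open>A\<close> is divided by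
      \<open>B\<close> because its increment acts on a value of \<open>\<phi>\<close>.\<close>
    define \<epsilon> where "\<epsilon> = \<delta> * \<nu> / (4 * N)"
    have \<epsilon>: "\<epsilon> > 0" "2 * N * \<epsilon> / \<nu> = \<delta> / 2"
      using \<delta> N \<nu> by (auto simp: \<epsilon>_def)
    have "uniformly_Cauchy_on {- l..l} (\<lambda>n. shift (s n) A)"
      by (intro converges_in_unif_compact_imp_uniformly_Cauchy conv_A compact_Icc)
    from this[unfolded uniformly_Cauchy_on_def, rule_format, of "\<epsilon> / (3 * B)"] obtain nA where nA:
      "\<forall>t\<in>{- l..l}. \<forall>m\<ge>nA. \<forall>n\<ge>nA. norm (A (t + s m) - A (t + s n)) < \<epsilon> / (3 * B)"
      using \<epsilon> B unfolding shift_def dist_norm by (meson divide_pos_pos mult_pos_pos zero_less_numeral)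
    have "uniformly_Cauchy_on {- l..l} (\<lambda>n. shift (s n) f)"
      by (intro converges_in_unif_compact_imp_uniformly_Cauchy conv_f compact_Icc)
    from this[unfolded uniformly_Cauchy_on_def, rule_format, of "\<epsilon> / 3"] obtain nf where nf:
      "\<forall>t\<in>{- l..l}. \<forall>m\<ge>nf. \<forall>n\<ge>nf. norm (f (t + s m) - f (t + s n)) < \<epsilon> / 3"
      using \<epsilon> unfolding shift_def dist_norm by (meson divide_pos_pos zero_less_numeral)
    have "uniformly_Cauchy_on ({- l..l} \<times> ?K) (\<lambda>n. shift2 (s n) (restrict F (UNIV \<times> ?K)))"
      by (intro converges_in_compact_open_imp_uniformly_Cauchy[OF conv_F] compact_Times K compact_Icc) auto
    from this[unfolded uniformly_Cauchy_on_def, rule_format, of "\<epsilon> / 3"] obtain nF where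
      "\<forall>z\<in>{- l..l} \<times> ?K. \<forall>m\<ge>nF. \<forall>n\<ge>nF. dist (shift2 (s m) (restrict F (UNIV \<times> ?K)) z)
        (shift2 (s n) (restrict F (UNIV \<times> ?K)) z) < \<epsilon> / 3"
      using \<epsilon> by auto
    then have nF: "norm (F (t + s m, x) - F (t + s n, x)) < \<epsilon> / 3"
      if "t \<in> {- l..l}" "x \<in> ?K" "m \<ge> nF" "n \<ge> nF" for t x m n
      using that by (force simp: dist_norm shift2_restrict)
    obtain nD where nD: "\<And>n t \<tau>. n \<ge> nD \<Longrightarrow> s n - l \<le> t \<Longrightarrow> t \<le> s n + l \<Longrightarrow>
        s n - l \<le> \<tau> \<Longrightarrow> \<tau> \<le> s n + l \<Longrightarrow>
        (\<tau> \<le> t \<longrightarrow> norm (transported A R t \<tau>) \<le> N * exp (- \<nu> * (t - \<tau>))) \<and>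
        (t \<le> \<tau> \<longrightarrow> norm (transported A (id_blinfun - R) t \<tau>) \<le> N * exp (- \<nu> * (\<tau> - t)))"
      using dich[of l] unfolding eventually_sequentially by blast
    define n0 where "n0 = Max {nA, nf, nF, nD}"
    have n0: "n0 \<ge> nA" "n0 \<ge> nf" "n0 \<ge> nF" "n0 \<ge> nD"
      unfolding n0_def by auto
    have "dist (\<phi> (t + s m)) (\<phi> (t + s n)) < e" if t: "t \<in> C" and m: "m \<ge> n0" and n: "n \<ge> n0" for t m n
    proof -
      \<comment> \<open>\<open>?y\<close> is \<open>?w\<close> in the original time,
        \<open>?y (t + s m) = ?w t\<close>, so that the dichotomy of \<open>A\<close> itself can be
        used instead of one for its translates.\<close>
      let ?w = "\<lambda>t. \<phi> (t + s m) - \<phi> (t + s n)"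
      let ?d = "s n - s m"
      let ?y = "\<lambda>\<sigma>. \<phi> \<sigma> - \<phi> (\<sigma> + ?d)"
      let ?g = "\<lambda>\<sigma>. blinfun_apply (A \<sigma> - A (\<sigma> + ?d)) (\<phi> (\<sigma> + ?d)) + (f \<sigma> - f (\<sigma> + ?d))
        + (F (\<sigma>, \<phi> \<sigma>) - F (\<sigma> + ?d, \<phi> (\<sigma> + ?d)))"
      have w_le: "norm (?w t) \<le> 2 * B" for t
        using norm_triangle_ineq4[of "\<phi> (t + s m)" "\<phi> (t + s n)"] B(2)[of "t + s m"] B(2)[of "t + s n"]
        by linarith
      have y': "(?y has_vector_derivative blinfun_apply (A \<sigma>) (?y \<sigma>) + ?g \<sigma>) (at \<sigma>)" for \<sigma>
      proof -
        have "((\<lambda>\<sigma>. \<sigma> + ?d) has_vector_derivative 1) (at \<sigma>)"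
          by (auto intro!: derivative_eq_intros)
        from vector_diff_chain_at[OF this assms(13)]
        have "(?y has_vector_derivative (blinfun_apply (A \<sigma>) (\<phi> \<sigma>) + f \<sigma> + F (\<sigma>, \<phi> \<sigma>))
            - (blinfun_apply (A (\<sigma> + ?d)) (\<phi> (\<sigma> + ?d)) + f (\<sigma> + ?d)
                + F (\<sigma> + ?d, \<phi> (\<sigma> + ?d)))) (at \<sigma>)"
          by (intro has_vector_derivative_diff assms(13)) (simp add: o_def)
        then show ?thesis
          by (simp add: blinfun.bilinear_simps algebra_simps)
      qed
      \<comment> \<open>The increment of \<open>F\<close> is split at
        \<open>F (\<tau> + s m, \<phi> (\<tau> + s n))\<close>: the change of state is controlled by
        the Lipschitz condition, the change of time by uniform closeness on the compact set
        \<open>?K\<close>.\<close>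
      have g_le: "norm (?g (\<tau> + s m)) \<le> \<epsilon> + L' * norm (?w \<tau>)" if \<tau>: "\<bar>\<tau>\<bar> \<le> l" for \<tau>
      proof -
        have \<tau>': "\<tau> \<in> {- l..l}" and eq: "\<tau> + s m + ?d = \<tau> + s n" using \<tau> by auto
        have \<phi>: "\<phi> (\<tau> + s n) \<in> ?K" using closure_subset[of "range \<phi>"] by auto
        have "norm (blinfun_apply (A (\<tau> + s m) - A (\<tau> + s n)) (\<phi> (\<tau> + s n))) \<le> \<epsilon> / (3 * B) * B"
          by (rule order.trans[OF norm_blinfun mult_mono])
            (use B nA[rule_format, OF \<tau>', of m n] m n n0 \<epsilon> in \<open>auto intro: less_imp_le\<close>)
        then have A_le: "norm (blinfun_apply (A (\<tau> + s m) - A (\<tau> + s n)) (\<phi> (\<tau> + s n))) \<le> \<epsilon> / 3"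
          using B by simp
        have f_le: "norm (f (\<tau> + s m) - f (\<tau> + s n)) \<le> \<epsilon> / 3"
          using nf[rule_format, OF \<tau>', of m n] m n n0 by simp
        have F_le: "norm (F (\<tau> + s m, \<phi> (\<tau> + s n)) - F (\<tau> + s n, \<phi> (\<tau> + s n))) \<le> \<epsilon> / 3"
          using nF[OF \<tau>' \<phi>, of m n] m n n0 by simp
        have F_lip: "norm (F (\<tau> + s m, \<phi> (\<tau> + s m)) - F (\<tau> + s m, \<phi> (\<tau> + s n))) \<le> L' * norm (?w \<tau>)"
          by (rule lip)
        have tri: "norm (x + y + (u - w)) \<le> norm x + norm y + norm (v - w) + norm (u - v)"
          for x y u v w :: 'a
          by norm
        from A_le f_le F_le F_lip show ?thesis
          unfolding eq
          using tri[of "blinfun_apply (A (\<tau> + s m) - A (\<tau> + s n)) (\<phi> (\<tau> + s n))"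
              "f (\<tau> + s m) - f (\<tau> + s n)" "F (\<tau> + s m, \<phi> (\<tau> + s m))"
              "F (\<tau> + s n, \<phi> (\<tau> + s n))" "F (\<tau> + s m, \<phi> (\<tau> + s n))"]
          by linarith
      qed
      have "norm (?w t) \<le> \<delta> / (1 - q) + q ^ k * (2 * B)"
      proof (rule bound_by_nested_intervals[where w = ?w and l = l and h = h, OF w_le])
        fix r c t :: real
        assume rh: "r + h \<le> l" and c: "\<And>\<tau>. \<bar>\<tau>\<bar> \<le> r + h \<Longrightarrow> norm (?w \<tau>) \<le> c" and t: "\<bar>t\<bar> \<le> r"
        have c0: "0 \<le> c" using c[of t] t h norm_ge_zero[of "?w t"] by linarith
        let ?b = "t + s m"
        \<comment> \<open>At the ends of the window the global bound \<open>2 * B\<close> suffices,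
          being damped by \<open>exp (- \<nu> * h)\<close>; inside it the forcing is estimated with
          the current bound \<open>c\<close>. The window stays within radius \<open>l\<close> of
          \<open>s m\<close> because \<open>r + h \<le> l\<close>.\<close>
        have "norm (?y ?b) \<le> N * (2 * B) * (exp (- \<nu> * (?b - (?b - h))) + exp (- \<nu> * (?b + h - ?b)))
            + 2 * N * (\<epsilon> + L' * c) / \<nu>"
        proof (rule dichotomy_estimate[OF assms(1) a])
          show "norm (transported A R t' \<tau>) \<le> N * exp (- \<nu> * (t' - \<tau>))"
            if "?b - h \<le> \<tau>" "\<tau> \<le> t'" "t' \<le> ?b + h" for t' \<tau>
            using nD[of m t' \<tau>] that m n0 rh t by auto
          show "norm (transported A (id_blinfun - R) t' \<tau>) \<le> N * exp (- \<nu> * (\<tau> - t'))"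
            if "?b - h \<le> t'" "t' \<le> \<tau>" "\<tau> \<le> ?b + h" for t' \<tau>
            using nD[of m t' \<tau>] that m n0 rh t by auto
          show "norm (?g \<sigma>) \<le> \<epsilon> + L' * c" if "?b - h \<le> \<sigma>" "\<sigma> \<le> ?b + h" for \<sigma>
          proof -
            have \<sigma>: "\<bar>\<sigma> - s m\<bar> \<le> r + h" using that t by auto
            have "norm (?g (\<sigma> - s m + s m)) \<le> \<epsilon> + L' * norm (?w (\<sigma> - s m))"
              using \<sigma> rh by (intro g_le) auto
            also have "\<dots> \<le> \<epsilon> + L' * c"
              using c[OF \<sigma>] L' by (intro add_left_mono mult_left_mono) auto
            finally show ?thesis by simp
          qed
          show "norm (?y (?b - h)) \<le> 2 * B" "norm (?y (?b + h)) \<le> 2 * B"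
            using w_le[of "t - h"] w_le[of "t + h"] by (simp_all add: algebra_simps)
          show "0 \<le> \<epsilon> + L' * c" using \<epsilon> L' c0 by simp
        qed (use N \<nu> h y' in auto)
        also have "\<dots> = 4 * N * B * exp (- \<nu> * h) + 2 * N * \<epsilon> / \<nu> + q * c"
          by (simp add: q_def algebra_simps add_divide_distrib)
        also have "\<dots> \<le> \<delta> + q * c" using h(2) \<epsilon>(2) by simp
        finally show "norm (?w t) \<le> \<delta> + q * c" by (simp add: algebra_simps)
      qed (use \<delta> q h r[OF t] in \<open>auto simp: l_def\<close>)
      also have "\<delta> / (1 - q) = e / 4" using q by (simp add: \<delta>_def field_simps)
      finally show ?thesis using k e by (simp add: dist_norm)
    qed
    then show "\<exists>M. \<forall>t\<in>C. \<forall>m\<ge>M. \<forall>n\<ge>M. dist (shift (s m) \<phi> t) (shift (s n) \<phi> t) < e"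
      unfolding shift_def by blast
  qed
  moreover have "continuous_on UNIV (shift h \<phi>)" for h
  proof -
    have "continuous_on UNIV \<phi>"
      using has_vector_derivative_continuous[OF assms(13)] by (simp add: continuous_at_imp_continuous_on)
    then show ?thesis
      unfolding shift_def by (rule continuous_on_compose2) (auto intro: continuous_intros)
  qed
  ultimately have "converges_in unif_compact_topology (\<lambda>n. shift (s n) \<phi>)"
    by (intro uniformly_Cauchy_imp_converges_in_unif_compact)
  then show "s \<in> limit_seqs \<phi>" using s by (simp add: limit_seqs_def)
qed

end
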